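(* Let $S_\infty$ be a set with subsets $S_1\subseteq S_2\subseteq\cdots$ such that $S_\infty=\bigcup_{n\ge1}S_n$. Let $(\mathrm{cl}_n)_{n\ge1}$ be closure operations on the $S_n$ and $\mathrm{cl}_\infty$ a closure operation on $S_\infty$ forming a consistent system, and let $(\varpi,\Pi)$ be a system of maps with $\varpi=\{\Pi_{m,n}\}_{m\le n}$. Let $\mathcal A=(A_n)_{n\ge1}$ be a $\varpi$-invariant, $(\mathrm{cl}_n)$-closed chain with limit $A_\infty=\bigcup_n A_n$. Consider the statements: (a) $\mathcal A$ stabilizes and is eventually finitely generated; (b) $A_\infty$ is $\Pi$-equivariantly finitely generated. Then: (i) If $A_\infty$ is $\mathrm{cl}_\infty$-closed, $(\varpi,\Pi)$ is weakly consistent, and $(\mathrm{cl}_n)_n$ and $\varpi$ are compatible, then (a) implies (b). (ii) If $\varpi$ is locally finite and $(\varpi,\Pi)$ is consistent, then (b) implies (a), and moreover in this case $\mathcal A$ is eventually saturated.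
   Context: A chain of sets is a sequence $\mathcal A=(A_n)_{n\ge1}$ with $A_n\subseteq S_n$ and $A_n\subseteq A_{n+1}$; its limit is $A_\infty=\bigcup_nA_n$. It is eventually saturated if $A_n=A_\infty\cap S_n$ for all sufficiently large $n$. A closure operation on a set $X$ is a map $A\mapsto A^{\mathrm{cl}}$ on subsets of $X$ with $A\subseteq A^{\mathrm{cl}}$, $(A^{\mathrm{cl}})^{\mathrm{cl}}=A^{\mathrm{cl}}$, and $A\subseteq B\Rightarrow A^{\mathrm{cl}}\subseteq B^{\mathrm{cl}}$; $A$ is closed if $A^{\mathrm{cl}}=A$. The system $((\mathrm{cl}_n)_n,\mathrm{cl}_\infty)$ is consistent if $(A\cap S_n)^{\mathrm{cl}_n}=A^{\mathrm{cl}_\infty}\cap S_n$ for all $n\ge1$ and $A\subseteq S_\infty$. A chain is $(\mathrm{cl}_n)$-closed if each $A_n$ is $\mathrm{cl}_n$-closed. A system of maps $(\varpi,\Pi)$ consists of a set $\Pi$ of maps $S_\infty\to S_\infty$ and, for each $m\le n$, a set $\Pi_{m,n}$ of maps $S_m\to S_n$; write $\Pi_{m,n}(A)=\{\pi(v):\pi\in\Pi_{m,n},v\in A\}$ and $\Pi(A)=\{\pi(v):\pi\in\Pi,v\in A\}$. $\varpi$ is locally finite if $\Pi_{m,n}(A)$ is finite for every $n\ge m$ and every finite $A\subseteq S_m$. $(\varpi,\Pi)$ is weakly consistent if $\Pi(A)=\bigcup_{n\ge m}\Pi_{m,n}(A)$ for all $m$ and $A\subseteq S_m$; it is consistent if $\Pi_{m,n}(A)=\Pi(A)\cap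 S_n$ for all $n\ge m$ and $A\subseteq S_m$. $(\mathrm{cl}_n)_n$ and $\varpi$ are compatible if $\Pi_{m,n}(A^{\mathrm{cl}_m})\subseteq(\Pi_{m,n}(A))^{\mathrm{cl}_n}$ for all $n\ge m$ and $A\subseteq S_m$. A $(\mathrm{cl}_n)$-closed chain $\mathcal A$ is $\varpi$-invariant if $(\Pi_{m,n}(A_m))^{\mathrm{cl}_n}\subseteq A_n$ whenever $n\ge m$; it stabilizes if there is $r$ with $(\Pi_{m,n}(A_m))^{\mathrm{cl}_n}=A_n$ for all $n\ge m\ge r$. It is eventually finitely generated if for all sufficiently large $n$ there is a finite $G_n\subseteq A_n$ with $A_n=G_n^{\mathrm{cl}_n}$. A $\mathrm{cl}_\infty$-closed set $A\subseteq S_\infty$ is $\Pi$-equivariantly finitely generated if there is a finite $G\subseteq A$ with $A=\Pi(G)^{\mathrm{cl}_\infty}$. *)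

theory Defs
  imports Main "HOL-Library.FuncSet"
begin

text \<open>
  Sequences indexed by the positive integers are functions on \<^typ>\<open>nat\<close>; the value at
  \<open>0\<close> is a junk value, and every definition below only looks at indices \<open>\<ge> 1\<close>. Similarly, a closure
  operation on a set \<open>X\<close> is a total function on sets, constrained only on the subsets of \<open>X\<close>.
\<close>

definition limit_set :: "(nat \<Rightarrow> 'a set) \<Rightarrow> 'a set" where
  "limit_set A = (\<Union>n\<in>{1..}. A n)"

definition increasing_sets :: "(nat \<Rightarrow> 'a set) \<Rightarrow> bool" where
  "increasing_sets A \<longleftrightarrow> (\<forall>n\<ge>1. A n \<subseteq> A (Suc n))"

definition chain_of_sets :: "(nat \<Rightarrow> 'a set) \<Rightarrow> (nat \<Rightarrow> 'a set) \<Rightarrow> bool" where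
  "chain_of_sets S A \<longleftrightarrow> (\<forall>n\<ge>1. A n \<subseteq> S n) \<and> increasing_sets A"

definition eventually_saturated :: "(nat \<Rightarrow> 'a set) \<Rightarrow> (nat \<Rightarrow> 'a set) \<Rightarrow> bool" where
  "eventually_saturated S A \<longleftrightarrow> (\<forall>\<^sub>F n in sequentially. A n = limit_set A \<inter> S n)"

definition closure_operation :: "'a set \<Rightarrow> ('a set \<Rightarrow> 'a set) \<Rightarrow> bool" where
  "closure_operation X cl \<longleftrightarrow>
     (\<forall>A. A \<subseteq> X \<longrightarrow> cl A \<subseteq> X) \<and>
     (\<forall>A. A \<subseteq> X \<longrightarrow> A \<subseteq> cl A) \<and>
     (\<forall>A. A \<subseteq> X \<longrightarrow> cl (cl A) = cl A) \<and>
     (\<forall>A B. A \<subseteq> B \<and> B \<subseteq> X \<longrightarrow> cl A \<subseteq> cl B)"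

definition closed_under :: "'a set \<Rightarrow> ('a set \<Rightarrow> 'a set) \<Rightarrow> 'a set \<Rightarrow> bool" where
  "closed_under X cl A \<longleftrightarrow> A \<subseteq> X \<and> cl A = A"

definition consistent_closures ::
    "(nat \<Rightarrow> 'a set) \<Rightarrow> 'a set \<Rightarrow> (nat \<Rightarrow> 'a set \<Rightarrow> 'a set) \<Rightarrow> ('a set \<Rightarrow> 'a set) \<Rightarrow> bool" where
  "consistent_closures S Sinf cl clinf \<longleftrightarrow>
     (\<forall>n\<ge>1. \<forall>A. A \<subseteq> Sinf \<longrightarrow> cl n (A \<inter> S n) = clinf A \<inter> S n)"

definition closed_chain ::
    "(nat \<Rightarrow> 'a set) \<Rightarrow> (nat \<Rightarrow> 'a set \<Rightarrow> 'a set) \<Rightarrow> (nat \<Rightarrow> 'a set) \<Rightarrow> bool" where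
  "closed_chain S cl A \<longleftrightarrow> chain_of_sets S A \<and> (\<forall>n\<ge>1. closed_under (S n) (cl n) (A n))"

text \<open>
  In a system of maps \<open>P m n\<close> (for \<open>1 \<le> m \<le> n\<close>) is the set of maps from \<open>S m\<close> to \<open>S n\<close>, and
  \<open>Pinf\<close> is the set of self-maps of \<open>Sinf\<close>. Maps are extensional functions, so
  that they are determined by their values on their domain.
\<close>

definition system_of_maps ::
    "(nat \<Rightarrow> 'a set) \<Rightarrow> 'a set \<Rightarrow> (nat \<Rightarrow> nat \<Rightarrow> ('a \<Rightarrow> 'a) set) \<Rightarrow> ('a \<Rightarrow> 'a) set \<Rightarrow> bool" where
  "system_of_maps S Sinf P Pinf \<longleftrightarrow>
     Pinf \<subseteq> (Sinf \<rightarrow>\<^sub>E Sinf) \<and>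
     (\<forall>m\<ge>1. \<forall>n\<ge>m. P m n \<subseteq> (S m \<rightarrow>\<^sub>E S n))"

definition maps_image :: "('a \<Rightarrow> 'a) set \<Rightarrow> 'a set \<Rightarrow> 'a set" where
  "maps_image F A = {f v | f v. f \<in> F \<and> v \<in> A}"

definition locally_finite_maps ::
    "(nat \<Rightarrow> 'a set) \<Rightarrow> (nat \<Rightarrow> nat \<Rightarrow> ('a \<Rightarrow> 'a) set) \<Rightarrow> bool" where
  "locally_finite_maps S P \<longleftrightarrow>
     (\<forall>m\<ge>1. \<forall>n\<ge>m. \<forall>A. A \<subseteq> S m \<and> finite A \<longrightarrow> finite (maps_image (P m n) A))"

definition weakly_consistent_maps ::
    "(nat \<Rightarrow> 'a set) \<Rightarrow> (nat \<Rightarrow> nat \<Rightarrow> ('a \<Rightarrow> 'a) set) \<Rightarrow> ('a \<Rightarrow> 'a) set \<Rightarrow> bool" where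
  "weakly_consistent_maps S P Pinf \<longleftrightarrow>
     (\<forall>m\<ge>1. \<forall>A. A \<subseteq> S m \<longrightarrow> maps_image Pinf A = (\<Union>n\<in>{m..}. maps_image (P m n) A))"

definition consistent_maps ::
    "(nat \<Rightarrow> 'a set) \<Rightarrow> (nat \<Rightarrow> nat \<Rightarrow> ('a \<Rightarrow> 'a) set) \<Rightarrow> ('a \<Rightarrow> 'a) set \<Rightarrow> bool" where
  "consistent_maps S P Pinf \<longleftrightarrow>
     (\<forall>m\<ge>1. \<forall>n\<ge>m. \<forall>A. A \<subseteq> S m \<longrightarrow> maps_image (P m n) A = maps_image Pinf A \<inter> S n)"

definition compatible ::
    "(nat \<Rightarrow> 'a set) \<Rightarrow> (nat \<Rightarrow> 'a set \<Rightarrow> 'a set) \<Rightarrow> (nat \<Rightarrow> nat \<Rightarrow> ('a \<Rightarrow> 'a) set) \<Rightarrow> bool" where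
  "compatible S cl P \<longleftrightarrow>
     (\<forall>m\<ge>1. \<forall>n\<ge>m. \<forall>A. A \<subseteq> S m \<longrightarrow>
        maps_image (P m n) (cl m A) \<subseteq> cl n (maps_image (P m n) A))"

definition invariant_chain ::
    "(nat \<Rightarrow> 'a set \<Rightarrow> 'a set) \<Rightarrow> (nat \<Rightarrow> nat \<Rightarrow> ('a \<Rightarrow> 'a) set) \<Rightarrow> (nat \<Rightarrow> 'a set) \<Rightarrow> bool" where
  "invariant_chain cl P A \<longleftrightarrow> (\<forall>m\<ge>1. \<forall>n\<ge>m. cl n (maps_image (P m n) (A m)) \<subseteq> A n)"

definition stabilizes ::
    "(nat \<Rightarrow> 'a set \<Rightarrow> 'a set) \<Rightarrow> (nat \<Rightarrow> nat \<Rightarrow> ('a \<Rightarrow> 'a) set) \<Rightarrow> (nat \<Rightarrow> 'a set) \<Rightarrow> bool" where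
  "stabilizes cl P A \<longleftrightarrow> (\<exists>r\<ge>1. \<forall>m\<ge>r. \<forall>n\<ge>m. cl n (maps_image (P m n) (A m)) = A n)"

definition eventually_finitely_generated ::
    "(nat \<Rightarrow> 'a set \<Rightarrow> 'a set) \<Rightarrow> (nat \<Rightarrow> 'a set) \<Rightarrow> bool" where
  "eventually_finitely_generated cl A \<longleftrightarrow>
     (\<forall>\<^sub>F n in sequentially. \<exists>G. finite G \<and> G \<subseteq> A n \<and> A n = cl n G)"

text \<open>
  The notion is only meant for closed sets. The first conjunct records this; for a closure
  operation on \<open>X\<close> and \<open>F\<close> a set of self-maps of \<open>X\<close> it also follows from the second one.
\<close>

definition equivariantly_finitely_generated ::
    "'a set \<Rightarrow> ('a set \<Rightarrow> 'a set) \<Rightarrow> ('a \<Rightarrow> 'a) set \<Rightarrow> 'a set \<Rightarrow> bool" where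
  "equivariantly_finitely_generated X cl F A \<longleftrightarrow>
     closed_under X cl A \<and> (\<exists>G. finite G \<and> G \<subseteq> A \<and> A = cl (maps_image F G))"

end

theory Submission
  imports Defs
begin

text \<open>
  Write \<open>\<Pi>\<close> for \<open>Pinf\<close>. Consistency of the closures identifies \<open>cl n B\<close> with the trace of
  \<open>clinf B\<close> on \<open>S n\<close> for \<open>B \<subseteq> S n\<close>. For (i), if \<open>G\<close> generates \<open>A m\<close> with \<open>m\<close> in the stable range,
  then compatibility gives \<open>A n = cl n (\<Pi>\<^bsub>m,n\<^esub>(G))\<close> for all \<open>n \<ge> m\<close>, and these sets exhaust
  the closure of \<open>\<Pi>(G)\<close>. For (ii), a finite generating set \<open>G\<close> of the limit already lies in some
  \<open>A r\<close>, and for \<open>n \<ge> m \<ge> r\<close> everything is squeezed in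
  \<open>Ainf \<inter> S n = cl n (\<Pi>(G) \<inter> S n) = cl n (\<Pi>\<^bsub>m,n\<^esub>(G)) \<subseteq> cl n (\<Pi>\<^bsub>m,n\<^esub>(A m)) \<subseteq> A n \<subseteq> Ainf \<inter> S n\<close>.
\<close>

lemma increasing_sets_mono:
  assumes "increasing_sets A" "1 \<le> m" "m \<le> n"
  shows "A m \<subseteq> A n"
  using assms(3)
proof (induction n rule: dec_induct)
  case (step n)
  then show ?case using assms(1,2) unfolding increasing_sets_def
    by (meson order_trans)
qed simp

lemma subset_limit_set: "1 \<le> n \<Longrightarrow> A n \<subseteq> limit_set A"
  by (auto simp: limit_set_def)

text \<open>Each of the finitely many points appears at some stage; since the chain increases, the
  largest of these stages contains them all.\<close>

lemma finite_subset_limit_set: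
  assumes "increasing_sets A" "finite G" "G \<subseteq> limit_set A"
  obtains r where "1 \<le> r" "G \<subseteq> A r"
proof -
  have "\<exists>r\<ge>1. G \<subseteq> A r"
    using assms(2,3)
  proof (induction G rule: finite_induct)
    case (insert x G)
    then obtain r k where rk: "1 \<le> r" "G \<subseteq> A r" "1 \<le> k" "x \<in> A k"
      by (auto simp: limit_set_def)
    have "A r \<subseteq> A (max r k)" "A k \<subseteq> A (max r k)"
      using increasing_sets_mono[OF assms(1)] rk by simp_all
    then show ?case
      using rk by (intro exI[of _ "max r k"]) auto
  qed auto
  then show thesis using that by blast
qed

lemma maps_image_mono: "B \<subseteq> C \<Longrightarrow> maps_image F B \<subseteq> maps_image F C"
  by (auto simp: maps_image_def)

lemma maps_image_subset: "F \<subseteq> (X \<rightarrow>\<^sub>E Y) \<Longrightarrow> B \<subseteq> X \<Longrightarrow> maps_image F B \<subseteq> Y"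
  by (auto simp: maps_image_def)

lemma closure_operationD:
  assumes "closure_operation X cl" "B \<subseteq> X"
  shows "cl B \<subseteq> X" "B \<subseteq> cl B" "cl (cl B) = cl B" "C \<subseteq> B \<Longrightarrow> cl C \<subseteq> cl B"
  using assms by (auto simp: closure_operation_def)

theorem theorem2p16:
  fixes S :: "nat \<Rightarrow> 'a set" and Sinf :: "'a set"
    and cl :: "nat \<Rightarrow> 'a set \<Rightarrow> 'a set" and clinf :: "'a set \<Rightarrow> 'a set"
    and P :: "nat \<Rightarrow> nat \<Rightarrow> ('a \<Rightarrow> 'a) set" and Pinf :: "('a \<Rightarrow> 'a) set"
    and A :: "nat \<Rightarrow> 'a set" and Ainf :: "'a set"
  assumes S_incr: "increasing_sets S"
    and Sinf: "Sinf = limit_set S"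
    and cl: "\<And>n. n \<ge> 1 \<Longrightarrow> closure_operation (S n) (cl n)"
    and clinf: "closure_operation Sinf clinf"
    and cl_consistent: "consistent_closures S Sinf cl clinf"
    and maps: "system_of_maps S Sinf P Pinf"
    and A_closed_chain: "closed_chain S cl A"
    and A_invariant: "invariant_chain cl P A"
    and Ainf: "Ainf = limit_set A"
  shows "(closed_under Sinf clinf Ainf \<and> weakly_consistent_maps S P Pinf \<and> compatible S cl P \<longrightarrow>
            stabilizes cl P A \<and> eventually_finitely_generated cl A \<longrightarrow>
            equivariantly_finitely_generated Sinf clinf Pinf Ainf)
       \<and> (locally_finite_maps S P \<and> consistent_maps S P Pinf \<longrightarrow>
            equivariantly_finitely_generated Sinf clinf Pinf Ainf \<longrightarrow>
            (stabilizes cl P A \<and> eventually_finitely_generated cl A) \<and> eventually_saturated S A)"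
proof (intro conjI impI)
  have inc: "increasing_sets A" and AS: "\<And>n. 1 \<le> n \<Longrightarrow> A n \<subseteq> S n"
    using A_closed_chain unfolding closed_chain_def chain_of_sets_def by blast+
  have SSinf: "\<And>n. 1 \<le> n \<Longrightarrow> S n \<subseteq> Sinf"
    by (simp add: Sinf subset_limit_set)
  have AAinf: "\<And>n. 1 \<le> n \<Longrightarrow> A n \<subseteq> Ainf"
    by (simp add: Ainf subset_limit_set)
  have AinfSinf: "Ainf \<subseteq> Sinf"
    unfolding Ainf limit_set_def using AS SSinf by force
  have P_S: "maps_image (P m n) B \<subseteq> S n" if "1 \<le> m" "m \<le> n" "B \<subseteq> S m" for m n B
    using maps that by (intro maps_image_subset[of _ "S m"]) (auto simp: system_of_maps_def)
  have P_cl_mono: "cl n (maps_image (P m n) B) \<subseteq> cl n (maps_image (P m n) C)"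
    if "1 \<le> m" "m \<le> n" "B \<subseteq> C" "C \<subseteq> S m" for m n B C
    using that by (intro closure_operationD(4)[OF cl] P_S maps_image_mono) auto
  have P_A: "cl n (maps_image (P m n) (A m)) \<subseteq> A n" if "1 \<le> m" "m \<le> n" for m n
    using A_invariant that by (auto simp: invariant_chain_def)
  \<comment> \<open>Invariance speaks of closures of images; extensivity of \<open>cl n\<close>
    transfers it to the images themselves.\<close>
  have P_A': "maps_image (P m n) B \<subseteq> A n" if "1 \<le> m" "m \<le> n" "B \<subseteq> A m" for m n B
  proof -
    have "maps_image (P m n) B \<subseteq> maps_image (P m n) (A m)"
      using that(3) by (rule maps_image_mono)
    also have "\<dots> \<subseteq> cl n (maps_image (P m n) (A m))"
      using that P_S AS by (intro closure_operationD(2)[OF cl]) auto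
    finally show ?thesis using P_A that by blast
  qed
  have trace: "cl n (B \<inter> S n) = clinf B \<inter> S n" if "1 \<le> n" "B \<subseteq> Sinf" for n B
    using cl_consistent that by (auto simp: consistent_closures_def)
  have Pinf_S: "maps_image Pinf B \<subseteq> Sinf" if "B \<subseteq> Sinf" for B
    using maps that by (intro maps_image_subset[of _ Sinf]) (auto simp: system_of_maps_def)

  show "equivariantly_finitely_generated Sinf clinf Pinf Ainf"
    if hyps: "closed_under Sinf clinf Ainf \<and> weakly_consistent_maps S P Pinf \<and> compatible S cl P"
      and fg: "stabilizes cl P A \<and> eventually_finitely_generated cl A"
  proof -
    obtain r where r: "1 \<le> r" "\<And>m n. r \<le> m \<Longrightarrow> m \<le> n \<Longrightarrow> cl n (maps_image (P m n) (A m)) = A n"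
      using fg by (auto simp: stabilizes_def)
    obtain N where N: "\<And>n. N \<le> n \<Longrightarrow> \<exists>G. finite G \<and> G \<subseteq> A n \<and> A n = cl n G"
      using fg by (auto simp: eventually_finitely_generated_def eventually_sequentially)
    \<comment> \<open>At this level the chain is already stable and \<open>A m\<close> has a finite
      generating set.\<close>
    define m where "m = max r N"
    have m: "1 \<le> m" "r \<le> m" "N \<le> m" using r(1) by (auto simp: m_def)
    obtain G where G: "finite G" "G \<subseteq> A m" "A m = cl m G" using N m by blast
    have GS: "G \<subseteq> S m" using G AS m by blast
    have GSinf: "G \<subseteq> Sinf" using GS SSinf m by blast
    have PinfG: "maps_image Pinf G = (\<Union>n\<in>{m..}. maps_image (P m n) G)"
      using hyps GS m by (simp add: weakly_consistent_maps_def)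
    have clA: "clinf Ainf = Ainf" using hyps by (simp add: closed_under_def)
    have "maps_image Pinf G \<subseteq> Ainf"
      unfolding PinfG using P_A' AAinf G m by (meson UN_least atLeast_iff order_trans)
    \<comment> \<open>Here the assumption that \<open>Ainf\<close> is closed enters.\<close>
    then have "clinf (maps_image Pinf G) \<subseteq> Ainf"
      using closure_operationD(4)[OF clinf AinfSinf] clA by blast
    moreover have "Ainf \<subseteq> clinf (maps_image Pinf G)"
    proof
      fix x assume "x \<in> Ainf"
      then obtain k where k: "1 \<le> k" "x \<in> A k" by (auto simp: Ainf limit_set_def)
      \<comment> \<open>The stage of \<open>x\<close> is raised to at least \<open>m\<close>, so
        that \<open>A n\<close> is determined by \<open>A m\<close> through stability.\<close>
      define n where "n = max k m"
      have n: "k \<le> n" "m \<le> n" "1 \<le> n" using m by (auto simp: n_def)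
      define B where "B = maps_image (P m n) G"
      have BS: "B \<subseteq> S n" unfolding B_def using P_S m n GS by blast
      have "maps_image (P m n) (A m) \<subseteq> cl n B"
        using hyps m n GS G(3) by (simp add: compatible_def B_def)
      \<comment> \<open>Stability rewrites \<open>A n\<close> as the closure of the image of
        \<open>A m\<close>, which compatibility has just placed inside
        \<open>cl n B\<close>.\<close>
      then have "A n \<subseteq> cl n (cl n B)"
        unfolding r(2)[OF m(2) n(2), symmetric]
        by (intro closure_operationD(4)[OF cl[OF n(3)]] closure_operationD(1)[OF cl[OF n(3)] BS])
      \<comment> \<open>Idempotence removes one closure; intersecting with \<open>S n\<close>
        changes nothing but gives the form needed to pass from \<open>cl n\<close> to
        \<open>clinf\<close>.\<close>
      also have "\<dots> = cl n (B \<inter> S n)"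
        using closure_operationD(3)[OF cl[OF n(3)] BS] BS by (simp add: Int_absorb2)
      also have "\<dots> \<subseteq> clinf B" using trace[OF n(3), of B] BS SSinf[OF n(3)] by simp
      also have "\<dots> \<subseteq> clinf (maps_image Pinf G)"
        using n by (intro closure_operationD(4)[OF clinf] Pinf_S[OF GSinf]) (auto simp: PinfG B_def)
      finally show "x \<in> clinf (maps_image Pinf G)"
        using k increasing_sets_mono[OF inc k(1) n(1)] by blast
    qed
    moreover have "G \<subseteq> Ainf" using G AAinf m by blast
    ultimately show ?thesis
      using hyps G(1) unfolding equivariantly_finitely_generated_def by blast
  qed

  assume hyps: "locally_finite_maps S P \<and> consistent_maps S P Pinf"
    and "equivariantly_finitely_generated Sinf clinf Pinf Ainf"
  then obtain G where G: "finite G" "G \<subseteq> Ainf" "Ainf = clinf (maps_image Pinf G)"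
    by (auto simp: equivariantly_finitely_generated_def)
  obtain r where r: "1 \<le> r" "G \<subseteq> A r"
    using finite_subset_limit_set[OF inc G(1)] G(2) Ainf by blast
  have GA: "G \<subseteq> A m" if "r \<le> m" for m
    using r increasing_sets_mono[OF inc r(1) that] by blast
  have squeeze: "A n = Ainf \<inter> S n" "A n = cl n (maps_image (P m n) G)"
      "cl n (maps_image (P m n) (A m)) = A n" if mn: "r \<le> m" "m \<le> n" for m n
  proof -
    have ge1: "1 \<le> m" "1 \<le> n" using r mn by auto
    have GS: "G \<subseteq> S m" using GA AS ge1 mn by blast
    have "Ainf \<inter> S n = cl n (maps_image Pinf G \<inter> S n)"
      unfolding G(3) using trace[OF ge1(2) Pinf_S] G(2) AinfSinf by simp
    \<comment> \<open>Consistency of the maps turns the trace of the whole orbit of \<open>G\<close>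
      into a single finite-level image.\<close>
    also have "maps_image Pinf G \<inter> S n = maps_image (P m n) G"
      using hyps ge1 mn GS by (simp add: consistent_maps_def)
    finally have 1: "Ainf \<inter> S n = cl n (maps_image (P m n) G)" .
    have 2: "cl n (maps_image (P m n) G) \<subseteq> cl n (maps_image (P m n) (A m))"
      using P_cl_mono ge1 mn GA AS by simp
    have 3: "cl n (maps_image (P m n) (A m)) \<subseteq> A n" "A n \<subseteq> Ainf \<inter> S n"
      using P_A AAinf AS ge1 mn by auto
    \<comment> \<open>The inclusions run from \<open>Ainf \<inter> S n\<close> back to itself, so
      every term between is equal.\<close>
    show "A n = Ainf \<inter> S n" "A n = cl n (maps_image (P m n) G)"
      "cl n (maps_image (P m n) (A m)) = A n"
      using 1 2 3 by blast+
  qed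
  show "stabilizes cl P A"
    unfolding stabilizes_def using r(1) squeeze(3) by blast
  show "eventually_saturated S A"
    unfolding eventually_saturated_def eventually_sequentially
    using squeeze(1)[OF order_refl] Ainf by blast
  \<comment> \<open>With the source level fixed at \<open>r\<close>, the image of \<open>G\<close>
    generates \<open>A n\<close> by \<open>squeeze\<close>; local finiteness makes it a finite
    generating set.\<close>
  have "finite (maps_image (P r n) G)" if "r \<le> n" for n
    using hyps that r G(1) AS[OF r(1)] by (simp add: locally_finite_maps_def)
  then have "\<exists>G'. finite G' \<and> G' \<subseteq> A n \<and> A n = cl n G'" if "r \<le> n" for n
    using that squeeze(2)[OF order_refl that] P_A'[OF r(1) that r(2)]
    by (intro exI[of _ "maps_image (P r n) G"] conjI)
  then show "eventually_finitely_generated cl A"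
    unfolding eventually_finitely_generated_def eventually_sequentially by blast
qed

end
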